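(* Let $n,m$ be positive integers. The vector spaces $\mathcal{S}(\mathbb{R}^m,\mathcal{S}_n')$ and $\mathcal{L}(\mathcal{S}_n,\mathcal{S}_m)$ are isomorphic. Namely, the map $$(\cdot)^{\wedge}:\mathcal{S}(\mathbb{R}^m,\mathcal{S}_n')\to\mathcal{L}(\mathcal{S}_n,\mathcal{S}_m),\qquad v\mapsto\widehat{v},$$ associating with each Schwartz family $v$ its operator $\widehat{v}$, is a vector space isomorphism. Moreover, the inverse of this isomorphism is the linear mapping $$(\cdot)^{\vee}:\mathcal{L}(\mathcal{S}_n,\mathcal{S}_m)\to\mathcal{S}(\mathbb{R}^m,\mathcal{S}_n'),\qquad A\mapsto A^{\vee}:=(\delta_p\circ A)_{p\in\mathbb{R}^m},$$ which, as a consequence, is an isomorphism too.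
   Context: $\mathbb{K}$ denotes $\mathbb{R}$ or $\mathbb{C}$. $\mathcal{S}_n$ is the Schwartz space of $\mathbb{K}$-valued rapidly decreasing smooth functions on $\mathbb{R}^n$ with its natural Fréchet topology, and $\mathcal{S}_n'$ is its topological dual, the space of tempered distributions on $\mathbb{R}^n$. $\mathcal{L}(\mathcal{S}_n,\mathcal{S}_m)$ is the vector space of all linear operators $\mathcal{S}_n\to\mathcal{S}_m$ continuous for the natural Fréchet topologies. For $p\in\mathbb{R}^m$, $\delta_p\in\mathcal{S}_m'$ is the Dirac distribution $\delta_p(\psi)=\psi(p)$. A family of tempered distributions indexed by $\mathbb{R}^m$ is a map $v:\mathbb{R}^m\to\mathcal{S}_n'$, $p\mapsto v_p$; families form a vector space under componentwise addition $(v+w)_p=v_p+w_p$ and scalar multiplication $(av)_p=av_p$. For $\phi\in\mathcal{S}_n$, its image under $v$ is the function $v(\phi):\mathbb{R}^m\to\mathbb{K}$, $v(\phi)(p):=v_p(\phi)$. The family $v$ is called a Schwartz family if $v(\phi)\in\mathcal{S}_m$ for every $\phi\in\mathcal{S}_n$. The set of all Schwartz families indexed by $\mathbb{R}^m$ in $\mathcal{S}_n'$ is denoted $\mathcal{S}(\mathbb{R}^m,\mathcal{S}_n')$; it is a subspace of the vector space of all families. The operator generated by a Schwartz family $v$ is the map $\widehat{v}:\mathcal{S}_n\to\mathcal{S}_m$, $\phi\mapsto v(\phi)$. *)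

theory Defs
  imports "HOL-Analysis.Analysis" "HOL-Library.Function_Algebras"
begin

section \<open>Schwartz functions\<close>

text \<open>The scalars are any \<open>real_normed_field\<close>. Adding the sort \<open>euclidean_space\<close> leaves exactly the
  real and the complex numbers up to isomorphism: both are instances, and by Frobenius there are
  no other finite-dimensional commutative real division algebras.\<close>

definition partial_deriv ::
  "'n::finite \<Rightarrow> (real^'n \<Rightarrow> 'k::real_normed_vector) \<Rightarrow> real^'n \<Rightarrow> 'k" where
  "partial_deriv i f = (\<lambda>x. frechet_derivative f (at x) (axis i 1))"

text \<open>A list of coordinate directions plays the role of a multi-index of derivatives. Mixed
  partial derivatives of smooth functions commute, so lists only enumerate the usual
  derivatives with repetitions.\<close>

primrec iter_partial ::
  "'n::finite list \<Rightarrow> (real^'n \<Rightarrow> 'k::real_normed_vector) \<Rightarrow> real^'n \<Rightarrow> 'k" where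
  "iter_partial [] f = f"
| "iter_partial (i # is) f = partial_deriv i (iter_partial is f)"

text \<open>Class C-infinity: partial derivatives of all orders exist and are (totally)
  differentiable, hence continuous.\<close>

definition smooth_fun :: "(real^'n::finite \<Rightarrow> 'k::real_normed_vector) \<Rightarrow> bool" where
  "smooth_fun f \<longleftrightarrow> (\<forall>is x. iter_partial is f differentiable (at x))"

definition monomial :: "('n::finite \<Rightarrow> nat) \<Rightarrow> real^'n \<Rightarrow> real" where
  "monomial \<alpha> x = (\<Prod>i\<in>UNIV. (x $ i) ^ \<alpha> i)"

definition schwartz_functions :: "(real^'n::finite \<Rightarrow> 'k::real_normed_vector) set" where
  "schwartz_functions =
     {f. smooth_fun f \<and>
         (\<forall>\<alpha> is. bounded (range (\<lambda>x. monomial \<alpha> x *\<^sub>R iter_partial is f x)))}"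

lemma iter_partial_zero: "iter_partial is (\<lambda>x. 0) = (\<lambda>x. 0)"
  by (induction "is") (simp_all add: partial_deriv_def)

lemma iter_partial_add:
  assumes "smooth_fun f" "smooth_fun g"
  shows "iter_partial is (\<lambda>x. f x + g x) = (\<lambda>x. iter_partial is f x + iter_partial is g x)"
proof (induction "is")
  case Nil
  show ?case by simp
next
  case (Cons i "is")
  have "((\<lambda>x. iter_partial is f x + iter_partial is g x) has_derivative
          (\<lambda>h. frechet_derivative (iter_partial is f) (at x) h +
               frechet_derivative (iter_partial is g) (at x) h)) (at x)" for x
    using assms by (intro has_derivative_add)
      (auto simp: smooth_fun_def frechet_derivative_works[symmetric])
  then have "frechet_derivative (\<lambda>x. iter_partial is f x + iter_partial is g x) (at x) =
      (\<lambda>h. frechet_derivative (iter_partial is f) (at x) h +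
           frechet_derivative (iter_partial is g) (at x) h)" for x
    by (rule frechet_derivative_at[symmetric])
  then show ?case
    by (simp add: Cons.IH partial_deriv_def)
qed

lemma iter_partial_scale:
  fixes c :: "'k::real_normed_algebra"
  assumes "smooth_fun f"
  shows "iter_partial is (\<lambda>x. c * f x) = (\<lambda>x. c * iter_partial is f x)"
proof (induction "is")
  case Nil
  show ?case by simp
next
  case (Cons i "is")
  have "((\<lambda>x. c * iter_partial is f x) has_derivative
          (\<lambda>h. c * frechet_derivative (iter_partial is f) (at x) h)) (at x)" for x
    using assms by (intro has_derivative_mult_right)
      (auto simp: smooth_fun_def frechet_derivative_works[symmetric])
  then have "frechet_derivative (\<lambda>x. c * iter_partial is f x) (at x) =
      (\<lambda>h. c * frechet_derivative (iter_partial is f) (at x) h)" for x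
    by (rule frechet_derivative_at[symmetric])
  then show ?case
    by (simp add: Cons.IH partial_deriv_def)
qed

lemma schwartz_functions_zero: "(\<lambda>x. 0) \<in> schwartz_functions"
  by (auto simp: schwartz_functions_def smooth_fun_def iter_partial_zero image_constant_conv)

lemma schwartz_functions_add:
  assumes "f \<in> schwartz_functions" "g \<in> schwartz_functions"
  shows "(\<lambda>x. f x + g x) \<in> schwartz_functions"
proof -
  have sm: "smooth_fun f" "smooth_fun g"
    using assms by (auto simp: schwartz_functions_def)
  have "smooth_fun (\<lambda>x. f x + g x)"
    using sm unfolding smooth_fun_def iter_partial_add[OF sm] by (auto intro!: differentiable_add)
  moreover have "bounded (range (\<lambda>x. monomial \<alpha> x *\<^sub>R iter_partial is (\<lambda>x. f x + g x) x))" for \<alpha> "is"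
    unfolding iter_partial_add[OF sm] scaleR_add_right
    using assms by (intro bounded_plus_comp) (auto simp: schwartz_functions_def)
  ultimately show ?thesis
    by (simp add: schwartz_functions_def)
qed

lemma schwartz_functions_scale:
  fixes c :: "'k::real_normed_algebra"
  assumes "f \<in> schwartz_functions"
  shows "(\<lambda>x. c * f x) \<in> schwartz_functions"
proof -
  have sm: "smooth_fun f"
    using assms by (auto simp: schwartz_functions_def)
  have "smooth_fun (\<lambda>x. c * f x)"
    unfolding smooth_fun_def
  proof (intro allI)
    fix "is" x
    have "iter_partial is f differentiable (at x)"
      using sm by (simp add: smooth_fun_def)
    then have "(\<lambda>x. c * iter_partial is f x) differentiable (at x)"
      by (rule differentiable_mult[OF differentiable_const])
    then show "iter_partial is (\<lambda>x. c * f x) differentiable (at x)"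
      by (simp only: iter_partial_scale[OF sm])
  qed
  moreover have "bounded (range (\<lambda>x. monomial \<alpha> x *\<^sub>R iter_partial is (\<lambda>x. c * f x) x))" for \<alpha> "is"
  proof -
    have "bounded (range (\<lambda>x. monomial \<alpha> x *\<^sub>R iter_partial is f x))"
      using assms by (simp add: schwartz_functions_def)
    then have "bounded ((\<lambda>y. c * y) ` range (\<lambda>x. monomial \<alpha> x *\<^sub>R iter_partial is f x))"
      by (rule bounded_linear_image[OF _ bounded_linear_mult_right])
    then show ?thesis
      by (simp only: iter_partial_scale[OF sm] image_image mult_scaleR_right)
  qed
  ultimately show ?thesis
    by (simp add: schwartz_functions_def)
qed


section \<open>The Schwartz space as a topological vector space\<close>

typedef (overloaded) ('k::real_normed_field, 'n::finite) schwartz =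
  "schwartz_functions :: (real^'n \<Rightarrow> 'k) set"
  morphisms schwartz_apply Schwartz
  using schwartz_functions_zero by blast

setup_lifting type_definition_schwartz

instantiation schwartz :: (real_normed_field, finite) ab_group_add
begin

lift_definition zero_schwartz :: "('a, 'b) schwartz" is "\<lambda>x. 0"
  by (rule schwartz_functions_zero)

lift_definition plus_schwartz :: "('a, 'b) schwartz \<Rightarrow> ('a, 'b) schwartz \<Rightarrow> ('a, 'b) schwartz"
  is "\<lambda>f g x. f x + g x"
  by (rule schwartz_functions_add)

lift_definition uminus_schwartz :: "('a, 'b) schwartz \<Rightarrow> ('a, 'b) schwartz"
  is "\<lambda>f x. - f x"
  using schwartz_functions_scale[where c = "- 1 :: 'a"] by simp

lift_definition minus_schwartz :: "('a, 'b) schwartz \<Rightarrow> ('a, 'b) schwartz \<Rightarrow> ('a, 'b) schwartz"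
  is "\<lambda>f g x. f x - g x"
  using schwartz_functions_add[OF _ schwartz_functions_scale[where c = "- 1 :: 'a"]] by simp

instance
  by standard (transfer; simp add: algebra_simps)+

end

lift_definition schwartz_scale ::
  "'k::real_normed_field \<Rightarrow> ('k, 'n::finite) schwartz \<Rightarrow> ('k, 'n) schwartz"
  is "\<lambda>c f x. c * f x"
  by (rule schwartz_functions_scale)

definition schwartz_seminorm ::
  "('n \<Rightarrow> nat) \<times> 'n list \<Rightarrow> ('k::real_normed_field, 'n::finite) schwartz \<Rightarrow> real" where
  "schwartz_seminorm =
     (\<lambda>(\<alpha>, is) \<phi>. SUP x. norm (monomial \<alpha> x *\<^sub>R iter_partial is (schwartz_apply \<phi>) x))"

text \<open>The natural Frechet topology: the locally convex topology given by the seminorms.\<close>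

instantiation schwartz :: (real_normed_field, finite) topological_space
begin

definition open_schwartz :: "('a, 'b) schwartz set \<Rightarrow> bool" where
  "open_schwartz U \<longleftrightarrow>
     (\<forall>\<phi>\<in>U. \<exists>K e. finite K \<and> e > 0 \<and>
        {\<psi>. \<forall>k\<in>K. schwartz_seminorm k (\<psi> - \<phi>) < e} \<subseteq> U)"

instance
proof
  show "open (UNIV :: ('a, 'b) schwartz set)"
    unfolding open_schwartz_def by (auto intro!: exI[of _ "{}"] exI[of _ "1::real"])
next
  fix S T :: "('a, 'b) schwartz set"
  assume S: "open S" and T: "open T"
  show "open (S \<inter> T)"
    unfolding open_schwartz_def
  proof
    fix \<phi> assume "\<phi> \<in> S \<inter> T"
    then have \<phi>: "\<phi> \<in> S" "\<phi> \<in> T" by auto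
    obtain K e where K: "finite K" "e > 0" "{\<psi>. \<forall>k\<in>K. schwartz_seminorm k (\<psi> - \<phi>) < e} \<subseteq> S"
      using bspec[OF S[unfolded open_schwartz_def] \<phi>(1)] by (elim exE conjE)
    obtain L d where L: "finite L" "d > 0" "{\<psi>. \<forall>k\<in>L. schwartz_seminorm k (\<psi> - \<phi>) < d} \<subseteq> T"
      using bspec[OF T[unfolded open_schwartz_def] \<phi>(2)] by (elim exE conjE)
    show "\<exists>K e. finite K \<and> e > 0 \<and>
        {\<psi>. \<forall>k\<in>K. schwartz_seminorm k (\<psi> - \<phi>) < e} \<subseteq> S \<inter> T"
      by (rule exI[of _ "K \<union> L"], rule exI[of _ "min e d"]) (use K L in auto)
  qed
next
  fix \<U> :: "('a, 'b) schwartz set set"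
  assume \<U>: "\<forall>U\<in>\<U>. open U"
  show "open (\<Union>\<U>)"
    unfolding open_schwartz_def
  proof
    fix \<phi> assume "\<phi> \<in> \<Union>\<U>"
    then obtain U where U: "U \<in> \<U>" "\<phi> \<in> U" by blast
    have "open U" using \<U> U(1) by blast
    obtain K e where K: "finite K" "e > 0" "{\<psi>. \<forall>k\<in>K. schwartz_seminorm k (\<psi> - \<phi>) < e} \<subseteq> U"
      using bspec[OF \<open>open U\<close>[unfolded open_schwartz_def] U(2)] by (elim exE conjE)
    have "{\<psi>. \<forall>k\<in>K. schwartz_seminorm k (\<psi> - \<phi>) < e} \<subseteq> \<Union>\<U>"
      using K(3) U(1) by (meson Union_upper order_trans)
    then show "\<exists>K e. finite K \<and> e > 0 \<and>
        {\<psi>. \<forall>k\<in>K. schwartz_seminorm k (\<psi> - \<phi>) < e} \<subseteq> \<Union>\<U>"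
      using K(1,2) by (intro exI conjI)
  qed
qed

end


section \<open>Tempered distributions, Schwartz families and operators\<close>

definition tempered_distributions :: "(('k::real_normed_field, 'n::finite) schwartz \<Rightarrow> 'k) set" where
  "tempered_distributions =
     {u. Vector_Spaces.linear schwartz_scale (*) u \<and> continuous_on UNIV u}"

definition schwartz_operators ::
  "(('k::real_normed_field, 'n::finite) schwartz \<Rightarrow> ('k, 'm::finite) schwartz) set" where
  "schwartz_operators =
     {A. Vector_Spaces.linear schwartz_scale schwartz_scale A \<and> continuous_on UNIV A}"

definition dirac :: "real^'m::finite \<Rightarrow> ('k::real_normed_field, 'm) schwartz \<Rightarrow> 'k" where
  "dirac p \<psi> = schwartz_apply \<psi> p"

type_synonym ('k, 'n, 'm) family = "real^'m \<Rightarrow> ('k, 'n) schwartz \<Rightarrow> 'k"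

definition family_image ::
  "('k::real_normed_field, 'n::finite, 'm::finite) family \<Rightarrow> ('k, 'n) schwartz \<Rightarrow> real^'m \<Rightarrow> 'k" where
  "family_image v \<phi> = (\<lambda>p. v p \<phi>)"

definition schwartz_families :: "('k::real_normed_field, 'n::finite, 'm::finite) family set" where
  "schwartz_families =
     {v. (\<forall>p. v p \<in> tempered_distributions) \<and> (\<forall>\<phi>. family_image v \<phi> \<in> schwartz_functions)}"

text \<open>Only meaningful on \<open>schwartz_families\<close>, where \<open>Schwartz\<close> is applied to Schwartz functions.\<close>

definition family_operator ::
  "('k::real_normed_field, 'n::finite, 'm::finite) family \<Rightarrow> ('k, 'n) schwartz \<Rightarrow> ('k, 'm) schwartz" where
  "family_operator v = (\<lambda>\<phi>. Schwartz (family_image v \<phi>))"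

definition operator_family ::
  "(('k::real_normed_field, 'n::finite) schwartz \<Rightarrow> ('k, 'm::finite) schwartz) \<Rightarrow> ('k, 'n, 'm) family" where
  "operator_family A = (\<lambda>p. dirac p \<circ> A)"


section \<open>Isomorphisms of vector spaces\<close>

text \<open>Addition of functions is the pointwise one of \<open>Function_Algebras\<close>.\<close>

definition pointwise_scale :: "('k \<Rightarrow> 'v \<Rightarrow> 'v) \<Rightarrow> 'k \<Rightarrow> ('x \<Rightarrow> 'v) \<Rightarrow> 'x \<Rightarrow> 'v" where
  "pointwise_scale s c f = (\<lambda>x. s c (f x))"

definition family_scale ::
  "'k::real_normed_field \<Rightarrow> ('k, 'n::finite, 'm::finite) family \<Rightarrow> ('k, 'n, 'm) family" where
  "family_scale = pointwise_scale (pointwise_scale (*))"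

definition operator_scale ::
  "'k::real_normed_field \<Rightarrow> (('k, 'n::finite) schwartz \<Rightarrow> ('k, 'm::finite) schwartz) \<Rightarrow>
   ('k, 'n) schwartz \<Rightarrow> ('k, 'm) schwartz" where
  "operator_scale = pointwise_scale schwartz_scale"

text \<open>\<open>V\<close> and \<open>W\<close> are linear subspaces of ambient spaces with scalar multiplications
  \<open>sV\<close> and \<open>sW\<close>; only the values of \<open>f\<close> on \<open>V\<close> matter.\<close>

definition vector_space_iso_on ::
  "('k::field \<Rightarrow> 'v::ab_group_add \<Rightarrow> 'v) \<Rightarrow> 'v set \<Rightarrow>
   ('k \<Rightarrow> 'w::ab_group_add \<Rightarrow> 'w) \<Rightarrow> 'w set \<Rightarrow> ('v \<Rightarrow> 'w) \<Rightarrow> bool" where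
  "vector_space_iso_on sV V sW W f \<longleftrightarrow>
     vector_space sV \<and> module.subspace sV V \<and>
     vector_space sW \<and> module.subspace sW W \<and>
     (\<forall>x\<in>V. \<forall>y\<in>V. f (x + y) = f x + f y) \<and>
     (\<forall>c. \<forall>x\<in>V. f (sV c x) = sW c (f x)) \<and>
     bij_betw f V W"

end

theory Submission
  imports Defs
begin

text \<open>Reading a function of two variables \<open>(p, \<phi>)\<close> as a family of functionals or as an operator makes
  the two maps obviously linear and mutually inverse, and an operator gives a Schwartz family
  because evaluation at a point is continuous. The one substantial point is that the operator of
  a Schwartz family \<open>v\<close> is automatically continuous (\<open>family_operator_in_schwartz_operators\<close>), although
  only the continuity of each \<open>v p\<close> and the rapid decrease of \<open>p \<mapsto> v p \<phi>\<close> for each single \<open>\<phi>\<close>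
  are given.

  This is a Banach-Steinhaus phenomenon. The Schwartz space is complete (\<open>schwartz_complete\<close>), so
  a pointwise bounded set of tempered distributions is bounded by one continuous seminorm
  (\<open>schwartz_uniform_boundedness\<close>), and a pointwise limit of a sequence of tempered distributions
  is again one (\<open>tempered_distributions_limit\<close>). The latter is used once for every derivative: a
  partial derivative is a limit of difference quotients, so by induction on the number of
  derivatives, \<open>\<phi> \<mapsto> \<partial>\<^sup>\<beta> (v \<phi>) x\<close> is a tempered distribution for every \<open>x\<close>
  (\<open>iter_partial_family_tempered\<close>). The former is then applied to the functionals
  \<open>\<phi> \<mapsto> x\<^sup>\<alpha> \<partial>\<^sup>\<beta> (v \<phi>) x\<close>, with \<open>x\<close> varying. They are pointwise bounded since \<open>v \<phi>\<close> is a Schwartz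
  function, and a bound on them that is uniform in \<open>x\<close> is a bound on the seminorm
  \<open>(\<alpha>, \<beta>)\<close> of \<open>v \<phi>\<close> by a continuous seminorm of \<open>\<phi>\<close>.\<close>

section \<open>The seminorms\<close>

lemma vector_space_schwartz_scale:
  "vector_space (schwartz_scale :: 'k::real_normed_field \<Rightarrow> ('k, 'n::finite) schwartz \<Rightarrow> _)"
  by unfold_locales (transfer; simp add: algebra_simps)+

lemma linear_schwartz_iff:
  fixes A :: "('k::real_normed_field, 'n::finite) schwartz \<Rightarrow> ('k, 'm::finite) schwartz"
  shows "Vector_Spaces.linear schwartz_scale schwartz_scale A \<longleftrightarrow>
    (\<forall>\<phi> \<psi>. A (\<phi> + \<psi>) = A \<phi> + A \<psi>) \<and> (\<forall>c \<phi>. A (schwartz_scale c \<phi>) = schwartz_scale c (A \<phi>))"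
  by (simp add: Vector_Spaces.linear_def module_hom_def module_hom_axioms_def module_iff_vector_space
      vector_space_schwartz_scale)

lemma linear_functional_iff:
  fixes u :: "('k::real_normed_field, 'n::finite) schwartz \<Rightarrow> 'k"
  shows "Vector_Spaces.linear schwartz_scale (*) u \<longleftrightarrow>
    (\<forall>\<phi> \<psi>. u (\<phi> + \<psi>) = u \<phi> + u \<psi>) \<and> (\<forall>c \<phi>. u (schwartz_scale c \<phi>) = c * u \<phi>)"
  using vector_space_schwartz_scale vector_space_over_itself.vector_space_axioms
  by (auto simp: Vector_Spaces.linear_def module_hom_def module_hom_axioms_def module_iff_vector_space)

lemma smooth_fun_schwartz_apply: "smooth_fun (schwartz_apply \<phi>)"
  using schwartz_apply[of \<phi>] by (simp add: schwartz_functions_def)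

lemma iter_partial_schwartz_differentiable:
  "iter_partial is (schwartz_apply \<phi>) differentiable (at x)"
  using smooth_fun_schwartz_apply[of \<phi>] by (simp add: smooth_fun_def)

lemma iter_partial_schwartz_add:
  "iter_partial is (schwartz_apply (\<phi> + \<psi>)) x
    = iter_partial is (schwartz_apply \<phi>) x + iter_partial is (schwartz_apply \<psi>) x"
  by (simp add: plus_schwartz.rep_eq iter_partial_add smooth_fun_schwartz_apply)

lemma iter_partial_schwartz_scale:
  "iter_partial is (schwartz_apply (schwartz_scale c \<phi>)) x = c * iter_partial is (schwartz_apply \<phi>) x"
  by (simp add: schwartz_scale.rep_eq iter_partial_scale smooth_fun_schwartz_apply)

lemma iter_partial_schwartz_diff:
  "iter_partial is (schwartz_apply (\<phi> - \<psi>)) x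
    = iter_partial is (schwartz_apply \<phi>) x - iter_partial is (schwartz_apply \<psi>) x"
  using iter_partial_schwartz_add[of "is" "\<phi> - \<psi>" \<psi> x] by simp

lemma le_schwartz_seminorm:
  "norm (monomial \<alpha> x *\<^sub>R iter_partial is (schwartz_apply \<phi>) x) \<le> schwartz_seminorm (\<alpha>, is) \<phi>"
proof -
  have "bounded (range (\<lambda>x. monomial \<alpha> x *\<^sub>R iter_partial is (schwartz_apply \<phi>) x))"
    using schwartz_apply[of \<phi>] by (simp add: schwartz_functions_def)
  then have "bdd_above (range (\<lambda>x. norm (monomial \<alpha> x *\<^sub>R iter_partial is (schwartz_apply \<phi>) x)))"
    unfolding bounded_iff bdd_above_def by blast
  then show ?thesis
    unfolding schwartz_seminorm_def by (auto intro: cSUP_upper)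
qed

lemma schwartz_seminorm_le:
  assumes "\<And>x. norm (monomial \<alpha> x *\<^sub>R iter_partial is (schwartz_apply \<phi>) x) \<le> B"
  shows "schwartz_seminorm (\<alpha>, is) \<phi> \<le> B"
  unfolding schwartz_seminorm_def prod.case by (rule cSUP_least) (use assms in auto)

lemma schwartz_seminorm_nonneg: "schwartz_seminorm k \<phi> \<ge> 0"
proof (cases k)
  case (Pair \<alpha> "is")
  show ?thesis
    unfolding Pair by (rule order_trans[OF norm_ge_zero le_schwartz_seminorm[where x=0]])
qed

lemma schwartz_seminorm_triangle:
  "schwartz_seminorm k (\<phi> + \<psi>) \<le> schwartz_seminorm k \<phi> + schwartz_seminorm k \<psi>"
proof (cases k)
  case (Pair \<alpha> "is")
  show ?thesis
    unfolding Pair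
  proof (rule schwartz_seminorm_le)
    fix x
    show "norm (monomial \<alpha> x *\<^sub>R iter_partial is (schwartz_apply (\<phi> + \<psi>)) x)
        \<le> schwartz_seminorm (\<alpha>, is) \<phi> + schwartz_seminorm (\<alpha>, is) \<psi>"
      unfolding iter_partial_schwartz_add scaleR_add_right
      by (rule order_trans[OF norm_triangle_ineq add_mono[OF le_schwartz_seminorm le_schwartz_seminorm]])
  qed
qed

lemma schwartz_seminorm_scale:
  "schwartz_seminorm k (schwartz_scale c \<phi>) \<le> norm c * schwartz_seminorm k \<phi>"
proof (cases k)
  case (Pair \<alpha> "is")
  show ?thesis
    unfolding Pair
  proof (rule schwartz_seminorm_le)
    fix x
    have "norm (monomial \<alpha> x *\<^sub>R iter_partial is (schwartz_apply (schwartz_scale c \<phi>)) x)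
        = norm c * norm (monomial \<alpha> x *\<^sub>R iter_partial is (schwartz_apply \<phi>) x)"
      by (simp add: iter_partial_schwartz_scale norm_mult)
    also have "\<dots> \<le> norm c * schwartz_seminorm (\<alpha>, is) \<phi>"
      by (rule mult_left_mono[OF le_schwartz_seminorm]) simp
    finally show "norm (monomial \<alpha> x *\<^sub>R iter_partial is (schwartz_apply (schwartz_scale c \<phi>)) x)
        \<le> norm c * schwartz_seminorm (\<alpha>, is) \<phi>" .
  qed
qed

lemma schwartz_seminorm_zero: "schwartz_seminorm k 0 = 0"
  by (cases k) (simp add: schwartz_seminorm_def zero_schwartz.rep_eq iter_partial_zero)

lemma schwartz_seminorm_minus_commute:
  "schwartz_seminorm k (\<phi> - \<psi>) = schwartz_seminorm k (\<psi> - \<phi>)"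
proof (cases k)
  case (Pair \<alpha> "is")
  show ?thesis
    unfolding Pair schwartz_seminorm_def prod.case iter_partial_schwartz_diff scaleR_diff_right
    by (subst norm_minus_commute) simp
qed

text \<open>The seminorms are indexed by a countable type, so they can be replaced by an increasing sequence
  defining the same topology; a single index and radius then describe a basic neighbourhood.\<close>

definition graded_seminorm :: "nat \<Rightarrow> ('k::real_normed_field, 'n::finite) schwartz \<Rightarrow> real" where
  "graded_seminorm m \<phi> = (\<Sum>i\<le>m. schwartz_seminorm (from_nat i) \<phi>)"

lemma schwartz_seminorm_le_graded:
  assumes "to_nat k \<le> m"
  shows "schwartz_seminorm k \<phi> \<le> graded_seminorm m \<phi>"
  using member_le_sum[of "to_nat k" "{..m}" "\<lambda>i. schwartz_seminorm (from_nat i) \<phi>"] assms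
  by (simp add: graded_seminorm_def schwartz_seminorm_nonneg)

lemma graded_seminorm_mono: "m \<le> m' \<Longrightarrow> graded_seminorm m \<phi> \<le> graded_seminorm m' \<phi>"
  unfolding graded_seminorm_def by (rule sum_mono2) (auto simp: schwartz_seminorm_nonneg)

lemma graded_seminorm_nonneg: "graded_seminorm m \<phi> \<ge> 0"
  unfolding graded_seminorm_def by (simp add: sum_nonneg schwartz_seminorm_nonneg)

lemma graded_seminorm_zero: "graded_seminorm m 0 = 0"
  by (simp add: graded_seminorm_def schwartz_seminorm_zero)

lemma graded_seminorm_triangle:
  "graded_seminorm m (\<phi> + \<psi>) \<le> graded_seminorm m \<phi> + graded_seminorm m \<psi>"
  unfolding graded_seminorm_def sum.distrib[symmetric]
  by (rule sum_mono) (rule schwartz_seminorm_triangle)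

lemma graded_seminorm_scale:
  "graded_seminorm m (schwartz_scale c \<phi>) \<le> norm c * graded_seminorm m \<phi>"
  unfolding graded_seminorm_def sum_distrib_left
  by (rule sum_mono) (rule schwartz_seminorm_scale)

lemma graded_seminorm_minus_commute: "graded_seminorm m (\<phi> - \<psi>) = graded_seminorm m (\<psi> - \<phi>)"
  unfolding graded_seminorm_def by (simp add: schwartz_seminorm_minus_commute)

section \<open>Continuity in terms of the seminorms\<close>

text \<open>Homogeneity: rescale \<open>\<phi>\<close> into the ball. The factor is \<open>r / t\<close> for \<open>t\<close> slightly above the seminorm
  of \<open>\<phi>\<close>, as that seminorm may vanish; then \<open>t\<close> tends to it.\<close>

lemma linear_bound_of_ball_bound:
  fixes u :: "('k::real_normed_field, 'n::finite) schwartz \<Rightarrow> 'k"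
  assumes lin: "Vector_Spaces.linear schwartz_scale (*) u" and r: "r > 0"
    and bd: "\<And>\<phi>. graded_seminorm m \<phi> < r \<Longrightarrow> norm (u \<phi>) \<le> B"
  shows "norm (u \<phi>) \<le> B / r * graded_seminorm m \<phi>"
proof -
  have B: "B \<ge> 0"
    using bd[of 0] r by (simp add: graded_seminorm_zero) (meson norm_ge_zero order_trans)
  have *: "norm (u \<phi>) \<le> B / r * t" if t: "graded_seminorm m \<phi> < t" for t
  proof -
    have t0: "t > 0" using t graded_seminorm_nonneg[of m \<phi>] by simp
    let ?c = "of_real (r / t) :: 'k"
    have nc: "norm ?c = r / t" using r t0 by (simp only: norm_of_real) simp
    have "graded_seminorm m (schwartz_scale ?c \<phi>) \<le> r / t * graded_seminorm m \<phi>"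
      using graded_seminorm_scale[of m ?c \<phi>] nc by simp
    also have "\<dots> < r / t * t"
      using t r t0 by (intro mult_strict_left_mono) auto
    finally have "norm (u (schwartz_scale ?c \<phi>)) \<le> B"
      using t0 by (intro bd) simp
    moreover have "norm (u (schwartz_scale ?c \<phi>)) = r / t * norm (u \<phi>)"
      using lin nc by (simp only: linear_functional_iff norm_mult)
    ultimately have "r / t * norm (u \<phi>) \<le> B" by simp
    then show ?thesis using r t0 by (simp add: field_simps)
  qed
  have "((\<lambda>t. B / r * t) \<longlongrightarrow> B / r * graded_seminorm m \<phi>) (at_right (graded_seminorm m \<phi>))"
    by (intro tendsto_intros)
  moreover have "\<forall>\<^sub>F t in at_right (graded_seminorm m \<phi>). norm (u \<phi>) \<le> B / r * t"
    using * by (auto simp: eventually_at_filter)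
  ultimately show ?thesis
    by (rule tendsto_lowerbound) simp
qed

lemma tempered_distribution_bound:
  fixes u :: "('k::real_normed_field, 'n::finite) schwartz \<Rightarrow> 'k"
  assumes "u \<in> tempered_distributions"
  shows "\<exists>m C. C \<ge> 0 \<and> (\<forall>\<phi>. norm (u \<phi>) \<le> C * graded_seminorm m \<phi>)"
proof -
  have lin: "Vector_Spaces.linear schwartz_scale (*) u" and cont: "continuous_on UNIV u"
    using assms by (auto simp: tempered_distributions_def)
  have u0: "u 0 = 0"
    using lin[unfolded linear_functional_iff, THEN conjunct1, rule_format, of 0 0] by simp
  have "open (u -` ball 0 1)"
    using cont by (simp add: continuous_on_open_vimage)
  moreover have "0 \<in> u -` ball 0 1" by (simp add: u0)
  ultimately obtain K e where K: "finite K" "e > 0"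
    "{\<psi>. \<forall>k\<in>K. schwartz_seminorm k (\<psi> - 0) < e} \<subseteq> u -` ball 0 1"
    unfolding open_schwartz_def by meson
  define m where "m = Max (insert 0 (to_nat ` K))"
  have m: "to_nat k \<le> m" if "k \<in> K" for k
    unfolding m_def using K(1) that by (intro Max_ge) auto
  have "norm (u \<phi>) \<le> 1" if "graded_seminorm m \<phi> < e" for \<phi>
  proof -
    have "\<forall>k\<in>K. schwartz_seminorm k (\<phi> - 0) < e"
      using that schwartz_seminorm_le_graded[OF m, of _ \<phi>] by fastforce
    then have "\<phi> \<in> u -` ball 0 1" using K(3) by blast
    then show ?thesis by simp
  qed
  from linear_bound_of_ball_bound[OF lin K(2) this] show ?thesis
    using K(2) by (intro exI[of _ m] exI[of _ "1 / e"]) auto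
qed


lemma open_schwartzI_graded:
  fixes U :: "('k::real_normed_field, 'n::finite) schwartz set"
  assumes "\<And>\<phi>. \<phi> \<in> U \<Longrightarrow> \<exists>m e. e > 0 \<and> {\<psi>. graded_seminorm m (\<psi> - \<phi>) < e} \<subseteq> U"
  shows "open U"
  unfolding open_schwartz_def
proof
  fix \<phi> assume "\<phi> \<in> U"
  then obtain m e where e: "e > 0" and sub: "{\<psi>. graded_seminorm m (\<psi> - \<phi>) < e} \<subseteq> U"
    using assms by blast
  let ?K = "from_nat ` {..m} :: (('n \<Rightarrow> nat) \<times> 'n list) set"
  let ?d = "e / real (Suc m)"
  have "graded_seminorm m (\<psi> - \<phi>) < e"
    if "\<forall>k\<in>?K. schwartz_seminorm k (\<psi> - \<phi>) < ?d" for \<psi>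
  proof -
    have "graded_seminorm m (\<psi> - \<phi>) < (\<Sum>i\<le>m. ?d)"
      unfolding graded_seminorm_def by (rule sum_strict_mono) (use that in auto)
    also have "\<dots> = e" by (simp del: of_nat_Suc)
    finally show ?thesis .
  qed
  then show "\<exists>K e. finite K \<and> e > 0 \<and> {\<psi>. \<forall>k\<in>K. schwartz_seminorm k (\<psi> - \<phi>) < e} \<subseteq> U"
    using e sub by (intro exI[of _ ?K] exI[of _ ?d]) auto
qed

lemma tempered_distributionI:
  fixes u :: "('k::real_normed_field, 'n::finite) schwartz \<Rightarrow> 'k"
  assumes lin: "Vector_Spaces.linear schwartz_scale (*) u"
    and bd: "\<And>\<phi>. norm (u \<phi>) \<le> C * graded_seminorm m \<phi>"
  shows "u \<in> tempered_distributions"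
proof -
  have diff: "u (\<psi> - \<phi>) = u \<psi> - u \<phi>" for \<phi> \<psi>
    using lin[unfolded linear_functional_iff, THEN conjunct1, rule_format, of "\<psi> - \<phi>" \<phi>] by simp
  have "open (u -` V)" if V: "open V" for V
  proof (rule open_schwartzI_graded)
    fix \<phi> assume "\<phi> \<in> u -` V"
    then obtain e where e: "e > 0" "ball (u \<phi>) e \<subseteq> V"
      using V by (auto simp: open_contains_ball)
    have "u \<psi> \<in> ball (u \<phi>) e" if "graded_seminorm m (\<psi> - \<phi>) < e / (\<bar>C\<bar> + 1)" for \<psi>
    proof -
      have "norm (u \<psi> - u \<phi>) \<le> C * graded_seminorm m (\<psi> - \<phi>)"
        using bd[of "\<psi> - \<phi>"] by (simp add: diff)
      also have "\<dots> \<le> (\<bar>C\<bar> + 1) * graded_seminorm m (\<psi> - \<phi>)"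
        by (intro mult_right_mono) (auto simp: graded_seminorm_nonneg)
      also have "\<dots> < e"
        using that by (simp add: field_simps)
      finally show ?thesis by (simp add: dist_norm norm_minus_commute)
    qed
    then show "\<exists>m e. e > 0 \<and> {\<psi>. graded_seminorm m (\<psi> - \<phi>) < e} \<subseteq> u -` V"
      using e by (intro exI[of _ m] exI[of _ "e / (\<bar>C\<bar> + 1)"]) (auto simp del: mem_ball)
  qed
  then show ?thesis
    using lin by (auto simp: tempered_distributions_def continuous_on_open_vimage)
qed

lemma schwartz_operatorI:
  fixes A :: "('k::real_normed_field, 'n::finite) schwartz \<Rightarrow> ('k, 'm::finite) schwartz"
  assumes lin: "Vector_Spaces.linear schwartz_scale schwartz_scale A"
    and bd: "\<And>k. \<exists>m C. \<forall>\<phi>. schwartz_seminorm k (A \<phi>) \<le> C * graded_seminorm m \<phi>"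
  shows "A \<in> schwartz_operators"
proof -
  have diff: "A (\<psi> - \<phi>) = A \<psi> - A \<phi>" for \<phi> \<psi>
    using lin[unfolded linear_schwartz_iff, THEN conjunct1, rule_format, of "\<psi> - \<phi>" \<phi>] by simp
  obtain m C where bd: "\<And>k \<phi>. schwartz_seminorm k (A \<phi>) \<le> C k * graded_seminorm (m k) \<phi>"
    using bd by metis
  have "open (A -` V)" if V: "open V" for V
  proof (rule open_schwartzI_graded)
    fix \<phi> assume "\<phi> \<in> A -` V"
    then have "A \<phi> \<in> V" by simp
    then obtain K e where K: "finite K" "e > 0"
      "{\<psi>. \<forall>k\<in>K. schwartz_seminorm k (\<psi> - A \<phi>) < e} \<subseteq> V"
      using V unfolding open_schwartz_def by meson
    define M where "M = Max (insert 0 (m ` K))"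
    define D where "D = Max (insert 0 (C ` K))"
    have M: "m k \<le> M" if "k \<in> K" for k
      unfolding M_def using K(1) that by (intro Max_ge) auto
    have D: "C k \<le> D" if "k \<in> K" for k
      unfolding D_def using K(1) that by (intro Max_ge) auto
    have D0: "D \<ge> 0"
      unfolding D_def using K(1) by (intro Max_ge) auto
    have "A \<psi> \<in> V" if "graded_seminorm M (\<psi> - \<phi>) < e / (D + 1)" for \<psi>
    proof -
      have "schwartz_seminorm k (A \<psi> - A \<phi>) < e" if k: "k \<in> K" for k
      proof -
        have "schwartz_seminorm k (A \<psi> - A \<phi>) \<le> C k * graded_seminorm (m k) (\<psi> - \<phi>)"
          using bd[of k "\<psi> - \<phi>"] by (simp add: diff)
        also have "\<dots> \<le> (D + 1) * graded_seminorm M (\<psi> - \<phi>)"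
          using D[OF k] D0 graded_seminorm_mono[OF M[OF k]]
          by (intro mult_mono) (auto simp: graded_seminorm_nonneg)
        also have "\<dots> < e"
          using \<open>graded_seminorm M (\<psi> - \<phi>) < e / (D + 1)\<close> D0 by (simp add: field_simps)
        finally show ?thesis .
      qed
      then show ?thesis using K(3) by blast
    qed
    then show "\<exists>m e. e > 0 \<and> {\<psi>. graded_seminorm m (\<psi> - \<phi>) < e} \<subseteq> A -` V"
      using K(2) D0 by (intro exI[of _ M] exI[of _ "e / (D + 1)"]) auto
  qed
  then show ?thesis
    using lin by (auto simp: schwartz_operators_def continuous_on_open_vimage)
qed

section \<open>Completeness\<close>

text \<open>The Schwartz seminorms control partial derivatives only, whereas differentiability is total;
  this and the next lemma translate between the two.\<close>

lemma has_derivative_partials: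
  fixes f :: "real^'n::finite \<Rightarrow> 'k::real_normed_vector"
  assumes "f differentiable (at x)"
  shows "(f has_derivative (\<lambda>h. \<Sum>i\<in>UNIV. (h $ i) *\<^sub>R partial_deriv i f x)) (at x)"
proof -
  let ?D = "frechet_derivative f (at x)"
  have D: "(f has_derivative ?D) (at x)"
    using assms by (simp add: frechet_derivative_works)
  then interpret bounded_linear ?D by (rule has_derivative_bounded_linear)
  have "?D h = (\<Sum>i\<in>UNIV. (h $ i) *\<^sub>R partial_deriv i f x)" for h
  proof -
    have "?D h = ?D (\<Sum>i\<in>UNIV. (h $ i) *\<^sub>R axis i 1)"
      using basis_expansion[of h] by (simp add: scalar_mult_eq_scaleR)
    also have "\<dots> = (\<Sum>i\<in>UNIV. (h $ i) *\<^sub>R partial_deriv i f x)"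
      by (simp add: sum scaleR partial_deriv_def)
    finally show ?thesis .
  qed
  then show ?thesis using D by presburger
qed

lemma partial_deriv_eqI:
  fixes f :: "real^'n::finite \<Rightarrow> 'k::real_normed_vector"
  assumes "(f has_derivative (\<lambda>h. \<Sum>i\<in>UNIV. (h $ i) *\<^sub>R g i)) (at x)"
  shows "partial_deriv i f x = g i"
proof -
  have "partial_deriv i f x = (\<Sum>j\<in>UNIV. (axis i 1 $ j :: real) *\<^sub>R g j)"
    unfolding partial_deriv_def frechet_derivative_at[OF assms, symmetric] ..
  also have "\<dots> = (\<Sum>j\<in>UNIV. if j = i then g j else 0)"
    by (rule sum.cong) (auto simp: axis_def)
  finally show ?thesis by simp
qed

text \<open>All derivatives of a Cauchy sequence converge uniformly. Uniform convergence of the derivatives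
  of the next order makes the limit \<open>g is\<close> of the derivatives along \<open>is\<close> differentiable, with
  partial derivatives \<open>g (i # is)\<close>, so that \<open>g []\<close> is smooth and its derivatives are the \<open>g is\<close>.\<close>

lemma schwartz_complete:
  fixes X :: "nat \<Rightarrow> ('k::{real_normed_field, banach}, 'n::finite) schwartz"
  assumes cauchy: "\<And>k e. e > 0 \<Longrightarrow> \<exists>N. \<forall>i\<ge>N. \<forall>j\<ge>N. schwartz_seminorm k (X i - X j) < e"
  obtains \<phi> where "\<And>k. (\<lambda>j. schwartz_seminorm k (X j - \<phi>)) \<longlonglongrightarrow> 0"
proof -
  let ?d = "\<lambda>is j x. iter_partial is (schwartz_apply (X j)) x"
  have weighted: "norm (monomial \<alpha> x *\<^sub>R (?d is i x - ?d is j x)) \<le> schwartz_seminorm (\<alpha>, is) (X i - X j)"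
    for \<alpha> "is" i j x
    using le_schwartz_seminorm[of \<alpha> x "is" "X i - X j"] by (simp add: iter_partial_schwartz_diff)
  have unweighted: "norm (?d is i x - ?d is j x) \<le> schwartz_seminorm (\<lambda>_. 0, is) (X i - X j)"
    for "is" i j x
    using weighted[of "\<lambda>_. 0" x "is" i j] by (simp add: monomial_def)
  have "Cauchy (\<lambda>j. ?d is j x)" for "is" x
  proof (rule metric_CauchyI)
    fix e :: real assume "e > 0"
    from cauchy[OF this] obtain N where
      "\<forall>i\<ge>N. \<forall>j\<ge>N. schwartz_seminorm (\<lambda>_. 0, is) (X i - X j) < e" by blast
    then show "\<exists>N. \<forall>i\<ge>N. \<forall>j\<ge>N. dist (?d is i x) (?d is j x) < e"
      unfolding dist_norm using unweighted[of "is" _ x] order_le_less_trans by blast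
  qed
  then have "\<exists>l. (\<lambda>j. ?d is j x) \<longlonglongrightarrow> l" for "is" x
    by (simp add: Cauchy_convergent_iff convergent_def)
  then obtain g where g: "\<And>is x. (\<lambda>j. ?d is j x) \<longlonglongrightarrow> g is x"
    by metis
  have unif: "\<exists>N. \<forall>i\<ge>N. \<forall>x. norm (monomial \<alpha> x *\<^sub>R (?d is i x - g is x)) \<le> e"
    if e: "e > 0" for \<alpha> "is" and e :: real
  proof -
    from cauchy[OF e] obtain N where
      N: "\<forall>i\<ge>N. \<forall>j\<ge>N. schwartz_seminorm (\<alpha>, is) (X i - X j) < e" by blast
    have "norm (monomial \<alpha> x *\<^sub>R (?d is i x - g is x)) \<le> e" if i: "i \<ge> N" for i x
    proof (rule tendsto_upperbound)
      show "(\<lambda>j. norm (monomial \<alpha> x *\<^sub>R (?d is i x - ?d is j x)))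
          \<longlonglongrightarrow> norm (monomial \<alpha> x *\<^sub>R (?d is i x - g is x))"
        by (intro tendsto_intros g)
      show "\<forall>\<^sub>F j in sequentially. norm (monomial \<alpha> x *\<^sub>R (?d is i x - ?d is j x)) \<le> e"
        using eventually_ge_at_top[of N]
        by eventually_elim (use N i weighted[of \<alpha> x "is" i] in \<open>meson less_imp_le order_trans\<close>)
    qed simp
    then show ?thesis by blast
  qed
  have deriv: "(g is has_derivative (\<lambda>h. \<Sum>i\<in>UNIV. (h $ i) *\<^sub>R g (i # is) x)) (at x)" for "is" x
  proof -
    have "\<exists>G. \<forall>x\<in>UNIV. (\<lambda>j. ?d is j x) \<longlonglongrightarrow> G x \<and>
        (G has_derivative (\<lambda>h. \<Sum>i\<in>UNIV. (h $ i) *\<^sub>R g (i # is) x)) (at x within UNIV)"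
    proof (rule has_derivative_sequence)
      show "(?d is j has_derivative (\<lambda>h. \<Sum>i\<in>UNIV. (h $ i) *\<^sub>R ?d (i # is) j x)) (at x within UNIV)"
        for j x
        using has_derivative_partials[OF iter_partial_schwartz_differentiable[of "is" "X j" x]] by simp
      show "(\<lambda>j. ?d is j 0) \<longlonglongrightarrow> g is 0" by (rule g)
      fix e :: real assume e: "e > 0"
      let ?e = "e / real CARD('n)"
      have "\<exists>N. \<forall>j\<ge>N. \<forall>x. norm (?d (i # is) j x - g (i # is) x) \<le> ?e" for i
        using unif[of ?e "\<lambda>_. 0" "i # is"] e by (simp add: monomial_def)
      then have "\<forall>\<^sub>F j in sequentially. \<forall>i. \<forall>x. norm (?d (i # is) j x - g (i # is) x) \<le> ?e"
        by (intro eventually_all_finite) (simp only: eventually_sequentially)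
      then show "\<forall>\<^sub>F j in sequentially. \<forall>x\<in>UNIV. \<forall>h. norm ((\<Sum>i\<in>UNIV. (h $ i) *\<^sub>R ?d (i # is) j x)
          - (\<Sum>i\<in>UNIV. (h $ i) *\<^sub>R g (i # is) x)) \<le> e * norm h"
      proof (eventually_elim, intro ballI allI)
        fix j x and h :: "real^'n"
        assume H: "\<forall>i x. norm (?d (i # is) j x - g (i # is) x) \<le> ?e"
        have "norm ((\<Sum>i\<in>UNIV. (h $ i) *\<^sub>R ?d (i # is) j x) - (\<Sum>i\<in>UNIV. (h $ i) *\<^sub>R g (i # is) x))
            = norm (\<Sum>i\<in>UNIV. (h $ i) *\<^sub>R (?d (i # is) j x - g (i # is) x))"
          by (simp add: sum_subtractf scaleR_diff_right)
        also have "\<dots> \<le> (\<Sum>i\<in>(UNIV::'n set). norm h * ?e)"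
        proof (rule sum_norm_le)
          fix i
          show "norm ((h $ i) *\<^sub>R (?d (i # is) j x - g (i # is) x)) \<le> norm h * ?e"
            unfolding norm_scaleR
            by (intro mult_mono H[rule_format]) (auto simp: component_le_norm_cart)
        qed
        also have "\<dots> = e * norm h" by simp
        finally show "norm ((\<Sum>i\<in>UNIV. (h $ i) *\<^sub>R ?d (i # is) j x)
            - (\<Sum>i\<in>UNIV. (h $ i) *\<^sub>R g (i # is) x)) \<le> e * norm h" .
      qed
    qed auto
    then obtain G where G: "\<And>x. (\<lambda>j. ?d is j x) \<longlonglongrightarrow> G x"
      "\<And>x. (G has_derivative (\<lambda>h. \<Sum>i\<in>UNIV. (h $ i) *\<^sub>R g (i # is) x)) (at x)" by auto
    have "G = g is" using LIMSEQ_unique[OF G(1) g] by auto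
    then show ?thesis using G(2) by simp
  qed
  have iter: "iter_partial is (g []) = g is" for "is"
    by (induction "is") (auto simp: partial_deriv_eqI[OF deriv])
  have "smooth_fun (g [])"
    unfolding smooth_fun_def iter using deriv differentiableI by blast
  moreover have "bounded (range (\<lambda>x. monomial \<alpha> x *\<^sub>R iter_partial is (g []) x))" for \<alpha> "is"
  proof -
    obtain N where N: "\<And>x. norm (monomial \<alpha> x *\<^sub>R (?d is N x - g is x)) \<le> 1"
      using unif[of 1 \<alpha> "is"] by auto
    have "norm (monomial \<alpha> x *\<^sub>R g is x) \<le> schwartz_seminorm (\<alpha>, is) (X N) + 1" for x
    proof -
      have "monomial \<alpha> x *\<^sub>R g is x
          = monomial \<alpha> x *\<^sub>R ?d is N x - monomial \<alpha> x *\<^sub>R (?d is N x - g is x)"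
        by (simp add: scaleR_diff_right)
      then have "norm (monomial \<alpha> x *\<^sub>R g is x) \<le> norm (monomial \<alpha> x *\<^sub>R ?d is N x)
          + norm (monomial \<alpha> x *\<^sub>R (?d is N x - g is x))"
        using norm_triangle_ineq4 by metis
      then show ?thesis
        using N[of x] le_schwartz_seminorm[of \<alpha> x "is" "X N"] by linarith
    qed
    then show ?thesis unfolding iter bounded_iff by blast
  qed
  ultimately have "g [] \<in> schwartz_functions"
    by (simp add: schwartz_functions_def)
  then have app: "schwartz_apply (Schwartz (g [])) = g []" by (rule Schwartz_inverse)
  show thesis
  proof (rule that[of "Schwartz (g [])"])
    fix k :: "('n \<Rightarrow> nat) \<times> 'n list"
    obtain \<alpha> "is" where k: "k = (\<alpha>, is)" by fastforce
    show "(\<lambda>j. schwartz_seminorm k (X j - Schwartz (g []))) \<longlonglongrightarrow> 0"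
    proof (rule LIMSEQ_I)
      fix e :: real assume "e > 0"
      then obtain N where N: "\<forall>i\<ge>N. \<forall>x. norm (monomial \<alpha> x *\<^sub>R (?d is i x - g is x)) \<le> e / 2"
        using unif[of "e / 2" \<alpha> "is"] by auto
      have "schwartz_seminorm k (X j - Schwartz (g [])) \<le> e / 2" if "j \<ge> N" for j
        unfolding k using N that
        by (intro schwartz_seminorm_le) (simp add: iter_partial_schwartz_diff app iter)
      then show "\<exists>N. \<forall>j\<ge>N. norm (schwartz_seminorm k (X j - Schwartz (g [])) - 0) < e"
        using \<open>e > 0\<close> by (intro exI[of _ N]) (fastforce simp: schwartz_seminorm_nonneg)
    qed
  qed
qed

section \<open>Uniform boundedness\<close>

lemma tempered_distribution_diff:
  assumes "u \<in> tempered_distributions"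
  shows "u (\<phi> - \<psi>) = u \<phi> - u \<psi>"
proof -
  have "u (\<phi> - \<psi> + \<psi>) = u (\<phi> - \<psi>) + u \<psi>"
    using assms unfolding tempered_distributions_def linear_functional_iff by blast
  then show ?thesis by simp
qed

text \<open>The bound sought in the uniform boundedness theorem would follow from a common bound on one
  translated ball, because \<open>u \<xi> = u (\<xi> + x) - u x\<close>. If it fails, \<open>F\<close> is therefore unbounded on
  every ball.\<close>

lemma unbounded_on_ball:
  fixes F :: "(('k::real_normed_field, 'n::finite) schwartz \<Rightarrow> 'k) set"
  assumes F: "F \<subseteq> tempered_distributions"
    and unb: "\<And>m C. \<exists>u\<in>F. \<exists>\<phi>. norm (u \<phi>) > C * graded_seminorm m \<phi>"
    and r: "r > 0"
  shows "\<exists>u\<in>F. \<exists>y. graded_seminorm m (y - x) < r \<and> norm (u y) > B"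
proof (rule ccontr)
  assume "\<not> ?thesis"
  then have bd: "norm (u y) \<le> B" if "u \<in> F" "graded_seminorm m (y - x) < r" for u y
    using that by force
  have *: "norm (u \<phi>) \<le> 2 * B / r * graded_seminorm m \<phi>" if u: "u \<in> F" for u \<phi>
  proof (rule linear_bound_of_ball_bound[OF _ r])
    show "Vector_Spaces.linear schwartz_scale (*) u"
      using F u by (auto simp: tempered_distributions_def)
    fix \<xi> :: "('k, 'n) schwartz" assume "graded_seminorm m \<xi> < r"
    then have "norm (u (\<xi> + x)) \<le> B" "norm (u x) \<le> B"
      using bd[OF u, of "\<xi> + x"] bd[OF u, of x] r by (simp_all add: graded_seminorm_zero)
    moreover have "u \<xi> = u (\<xi> + x) - u x"
      using tempered_distribution_diff[OF subsetD[OF F u], of "\<xi> + x" x] by simp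
    ultimately show "norm (u \<xi>) \<le> 2 * B"
      using norm_triangle_ineq4[of "u (\<xi> + x)" "u x"] by simp
  qed
  obtain u \<phi> where "u \<in> F" "norm (u \<phi>) > 2 * B / r * graded_seminorm m \<phi>"
    using unb by blast
  then show False using *[of u \<phi>] by linarith
qed

text \<open>The step of the Baire category argument: by the previous lemma some functional is large at a
  point of the given ball, and by continuity it stays large on a small ball around that point.\<close>

lemma large_on_smaller_ball:
  fixes F :: "(('k::real_normed_field, 'n::finite) schwartz \<Rightarrow> 'k) set"
  assumes F: "F \<subseteq> tempered_distributions"
    and unb: "\<And>m C. \<exists>u\<in>F. \<exists>\<phi>. norm (u \<phi>) > C * graded_seminorm m \<phi>"
    and r: "r > 0" and \<epsilon>: "\<epsilon> > 0"
  shows "\<exists>x' m' r'. r' > 0 \<and> r' \<le> \<epsilon> \<and> m' \<ge> N \<and>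
    {y. graded_seminorm m' (y - x') \<le> r'} \<subseteq> {y. graded_seminorm m (y - x) \<le> r} \<and>
    (\<exists>u\<in>F. \<forall>y. graded_seminorm m' (y - x') \<le> r' \<longrightarrow> norm (u y) > B)"
proof -
  obtain u x' where u: "u \<in> F" and x': "graded_seminorm m (x' - x) < r" "norm (u x') > B"
    using unbounded_on_ball[OF F unb r] by blast
  have u_temp: "u \<in> tempered_distributions" using u F by blast
  from tempered_distribution_bound[OF this]
  obtain k C where C: "C \<ge> 0" "\<And>\<phi>. norm (u \<phi>) \<le> C * graded_seminorm k \<phi>"
    by auto
  define m' where "m' = max N (max m k)"
  define r' where "r' = min \<epsilon> (min (r - graded_seminorm m (x' - x)) ((norm (u x') - B) / (C + 1)))"
  have r': "r' > 0" "r' \<le> \<epsilon>" "r' \<le> r - graded_seminorm m (x' - x)" "r' \<le> (norm (u x') - B) / (C + 1)"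
    using \<epsilon> x' C(1) by (auto simp: r'_def)
  have "graded_seminorm m (y - x) \<le> r \<and> norm (u y) > B" if y: "graded_seminorm m' (y - x') \<le> r'" for y
  proof
    have "graded_seminorm m (y - x) \<le> graded_seminorm m (y - x') + graded_seminorm m (x' - x)"
      using graded_seminorm_triangle[of m "y - x'" "x' - x"] by simp
    moreover have "graded_seminorm m (y - x') \<le> graded_seminorm m' (y - x')"
      by (rule graded_seminorm_mono) (simp add: m'_def)
    ultimately show "graded_seminorm m (y - x) \<le> r" using y r'(3) by simp
    have "norm (u x' - u y) \<le> C * graded_seminorm k (y - x')"
      using C(2)[of "x' - y"] by (simp add: tempered_distribution_diff[OF u_temp]
          graded_seminorm_minus_commute[of k y x'])
    also have "\<dots> \<le> C * r'"
      using order_trans[OF graded_seminorm_mono y, of k] C(1)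
      by (intro mult_left_mono) (simp_all add: m'_def)
    also have "\<dots> < (C + 1) * r'" using r'(1) by (simp add: algebra_simps)
    also have "\<dots> \<le> norm (u x') - B" using r'(4) C(1) by (simp add: field_simps)
    finally show "norm (u y) > B"
      using norm_triangle_ineq2[of "u x'" "u y"] by simp
  qed
  then show ?thesis
    using r' u by (intro exI[of _ x'] exI[of _ m'] exI[of _ r']) (auto simp: m'_def)
qed

text \<open>Otherwise the previous lemma yields a decreasing sequence of balls, on the \<open>n\<close>-th of which some
  functional in \<open>F\<close> exceeds \<open>n\<close>. Radii tend to \<open>0\<close> and seminorm indices to infinity, so the centres
  are Cauchy for every seminorm. By completeness they have a limit; it lies in all the balls
  since they are closed, and \<open>F\<close> is unbounded there.\<close>

theorem schwartz_uniform_boundedness: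
  fixes F :: "(('k::{real_normed_field, banach}, 'n::finite) schwartz \<Rightarrow> 'k) set"
  assumes F: "F \<subseteq> tempered_distributions"
    and pointwise: "\<And>\<phi>. \<exists>B. \<forall>u\<in>F. norm (u \<phi>) \<le> B"
  shows "\<exists>m C. \<forall>u\<in>F. \<forall>\<phi>. norm (u \<phi>) \<le> C * graded_seminorm m \<phi>"
proof (rule ccontr)
  assume "\<not> ?thesis"
  then have unb: "\<And>m C. \<exists>u\<in>F. \<exists>\<phi>. norm (u \<phi>) > C * graded_seminorm m \<phi>"
    by (meson not_le)
  \<comment> \<open>A ball is encoded by its centre, the index of its seminorm and its radius.\<close>
  define ball where "ball = (\<lambda>(x :: ('k, 'n) schwartz, m, r). {y. graded_seminorm m (y - x) \<le> r})"
  have "\<exists>b. \<forall>n. (case b n of (x, m, r) \<Rightarrow> r > 0) \<and>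
      (case b (Suc n) of (x, m, r) \<Rightarrow> r \<le> 1 / real (Suc n) \<and> m \<ge> n) \<and>
      ball (b (Suc n)) \<subseteq> ball (b n) \<and> (\<exists>u\<in>F. \<forall>y\<in>ball (b (Suc n)). norm (u y) > real n)"
  proof (rule dependent_nat_choice)
    show "\<exists>b :: ('k, 'n) schwartz \<times> nat \<times> real. case b of (x, m, r) \<Rightarrow> r > 0"
      by (intro exI[of _ "(0, 0, 1)"]) simp
  next
    fix b :: "('k, 'n) schwartz \<times> nat \<times> real" and n
    assume pos: "case b of (x, m, r) \<Rightarrow> r > 0"
    obtain x m r where b: "b = (x, m, r)" by (cases b) auto
    show "\<exists>b'. (case b' of (x, m, r) \<Rightarrow> r > 0) \<and>
        (case b' of (x, m, r) \<Rightarrow> r \<le> 1 / real (Suc n) \<and> m \<ge> n) \<and>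
        ball b' \<subseteq> ball b \<and> (\<exists>u\<in>F. \<forall>y\<in>ball b'. norm (u y) > real n)"
    proof -
      obtain x' m' r' where "r' > 0" "r' \<le> 1 / real (Suc n)" "m' \<ge> n"
        "{y. graded_seminorm m' (y - x') \<le> r'} \<subseteq> {y. graded_seminorm m (y - x) \<le> r}"
        "\<exists>u\<in>F. \<forall>y. graded_seminorm m' (y - x') \<le> r' \<longrightarrow> norm (u y) > real n"
        using large_on_smaller_ball[OF F unb, of r "1 / real (Suc n)" n m x "real n"] pos
        by (auto simp: b simp del: of_nat_Suc)
      then show ?thesis
        by (intro exI[of _ "(x', m', r')"]) (simp add: ball_def b del: of_nat_Suc)
    qed
  qed
  then obtain b where b: "\<And>n. case b n of (x, m, r) \<Rightarrow> r > 0"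
    "\<And>n. case b (Suc n) of (x, m, r) \<Rightarrow> r \<le> 1 / real (Suc n) \<and> m \<ge> n"
    "\<And>n. ball (b (Suc n)) \<subseteq> ball (b n)"
    "\<And>n. \<exists>u\<in>F. \<forall>y\<in>ball (b (Suc n)). norm (u y) > real n" by metis
  define X where "X n = fst (b n)" for n
  define M where "M n = fst (snd (b n))" for n
  define R where "R n = snd (snd (b n))" for n
  have ball_b: "ball (b n) = {y. graded_seminorm (M n) (y - X n) \<le> R n}" for n
    by (simp add: ball_def X_def M_def R_def split: prod.split)
  have R: "R n > 0" "R (Suc n) \<le> 1 / real (Suc n)" "M (Suc n) \<ge> n" for n
    using b(1)[of n] b(2)[of n] by (auto simp: R_def M_def case_prod_beta simp del: of_nat_Suc)
  have "X n \<in> ball (b n)" for n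
    using R(1)[of n] by (simp add: ball_b graded_seminorm_zero)
  moreover have "ball (b j) \<subseteq> ball (b i)" if "i \<le> j" for i j
    using that b(3) lift_Suc_antimono_le[of "\<lambda>n. ball (b n)"] by blast
  ultimately have X: "graded_seminorm (M i) (X j - X i) \<le> R i" if "i \<le> j" for i j
    using that by (auto simp: ball_b subset_iff)
  have "\<exists>N. \<forall>i\<ge>N. \<forall>j\<ge>N. schwartz_seminorm k (X i - X j) < e" if e: "e > 0" for k and e :: real
  proof -
    obtain n where n: "n \<ge> to_nat k" "1 / real (Suc n) < e / 2"
    proof -
      obtain n0 where "inverse (real (Suc n0)) < e / 2"
        using reals_Archimedean[of "e / 2"] e by auto
      moreover have "1 / real (Suc (max n0 (to_nat k))) \<le> inverse (real (Suc n0))"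
        by (simp add: field_simps)
      ultimately show thesis by (intro that[of "max n0 (to_nat k)"]) auto
    qed
    have *: "schwartz_seminorm k (X i - X (Suc n)) < e / 2" if i: "i \<ge> Suc n" for i
    proof -
      have "schwartz_seminorm k (X i - X (Suc n)) \<le> graded_seminorm (M (Suc n)) (X i - X (Suc n))"
        using n(1) R(3)[of n] by (intro schwartz_seminorm_le_graded) simp
      also have "\<dots> \<le> 1 / real (Suc n)" using X[OF i] R(2)[of n] by simp
      finally show ?thesis using n(2) by simp
    qed
    have "schwartz_seminorm k (X i - X j) < e" if "i \<ge> Suc n" "j \<ge> Suc n" for i j
      using schwartz_seminorm_triangle[of k "X i - X (Suc n)" "X (Suc n) - X j"] *[OF that(1)] *[OF that(2)]
        schwartz_seminorm_minus_commute[of k "X j" "X (Suc n)"] by simp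
    then show ?thesis by blast
  qed
  then obtain \<phi> where lim: "\<And>k. (\<lambda>j. schwartz_seminorm k (X j - \<phi>)) \<longlonglongrightarrow> 0"
    using schwartz_complete[of X] by blast
  have glim: "(\<lambda>j. graded_seminorm m (X j - \<phi>)) \<longlonglongrightarrow> 0" for m
    unfolding graded_seminorm_def by (rule tendsto_null_sum) (rule lim)
  have mem: "\<phi> \<in> ball (b i)" for i
  proof -
    have "graded_seminorm (M i) (\<phi> - X i) \<le> R i"
    proof (rule tendsto_lowerbound)
      show "(\<lambda>j. graded_seminorm (M i) (X j - \<phi>) + R i) \<longlonglongrightarrow> R i"
        using tendsto_add[OF glim tendsto_const, of "M i" "R i"] by simp
      show "\<forall>\<^sub>F j in sequentially. graded_seminorm (M i) (\<phi> - X i) \<le> graded_seminorm (M i) (X j - \<phi>) + R i"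
        using eventually_ge_at_top[of i]
      proof eventually_elim
        case (elim j)
        show ?case
          using X[OF elim] graded_seminorm_triangle[of "M i" "\<phi> - X j" "X j - X i"]
            graded_seminorm_minus_commute[of "M i" \<phi> "X j"] by simp
      qed
    qed simp
    then show ?thesis by (simp add: ball_b)
  qed
  obtain B where B: "\<And>u. u \<in> F \<Longrightarrow> norm (u \<phi>) \<le> B"
    using pointwise[of \<phi>] by blast
  obtain n where "B \<le> real n" using real_arch_simple by blast
  then show False
    using b(4)[of n] mem[of "Suc n"] B by force
qed

text \<open>Convergent sequences are bounded, so the sequence is dominated by one continuous seminorm, and
  the bound passes to the limit.\<close>

corollary tempered_distributions_limit:
  fixes u :: "nat \<Rightarrow> ('k::{real_normed_field, banach}, 'n::finite) schwartz \<Rightarrow> 'k"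
  assumes u: "\<And>j. u j \<in> tempered_distributions" and lim: "\<And>\<phi>. (\<lambda>j. u j \<phi>) \<longlonglongrightarrow> w \<phi>"
  shows "w \<in> tempered_distributions"
proof -
  have "\<exists>B. \<forall>f\<in>range u. norm (f \<phi>) \<le> B" for \<phi>
    using convergent_imp_Bseq[OF convergentI[OF lim[of \<phi>]]] by (auto simp: Bseq_def)
  then obtain m C where bd: "\<And>j \<phi>. norm (u j \<phi>) \<le> C * graded_seminorm m \<phi>"
    using schwartz_uniform_boundedness[of "range u"] u by blast
  have lin: "u j (\<phi> + \<psi>) = u j \<phi> + u j \<psi>" "u j (schwartz_scale c \<phi>) = c * u j \<phi>" for j \<phi> \<psi> c
    using u[of j] by (auto simp: tempered_distributions_def linear_functional_iff)
  show ?thesis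
  proof (rule tempered_distributionI)
    show "Vector_Spaces.linear schwartz_scale (*) w"
      unfolding linear_functional_iff
    proof (intro conjI allI)
      fix \<phi> \<psi> c
      show "w (\<phi> + \<psi>) = w \<phi> + w \<psi>"
        using lim[of "\<phi> + \<psi>"] tendsto_add[OF lim lim, of \<phi> \<psi>] unfolding lin by (rule LIMSEQ_unique)
      show "w (schwartz_scale c \<phi>) = c * w \<phi>"
        using lim[of "schwartz_scale c \<phi>"] tendsto_mult_left[OF lim, of c \<phi>] unfolding lin
        by (rule LIMSEQ_unique)
    qed
    show "norm (w \<phi>) \<le> C * graded_seminorm m \<phi>" for \<phi>
      by (rule tendsto_upperbound[OF tendsto_norm[OF lim]]) (auto simp: bd)
  qed
qed

section \<open>Families and operators\<close>

lemma tempered_distributions_add: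
  assumes "u \<in> tempered_distributions" "w \<in> tempered_distributions"
  shows "(\<lambda>\<phi>. u \<phi> + w \<phi>) \<in> tempered_distributions"
  using assms unfolding tempered_distributions_def linear_functional_iff
  by (auto simp: algebra_simps intro: continuous_on_add)

lemma tempered_distributions_scale:
  assumes "u \<in> tempered_distributions"
  shows "(\<lambda>\<phi>. c * u \<phi>) \<in> tempered_distributions"
  using assms unfolding tempered_distributions_def linear_functional_iff
  by (auto simp: algebra_simps intro: continuous_on_mult_left)

lemma partial_deriv_LIMSEQ:
  fixes f :: "real^'n::finite \<Rightarrow> 'k::real_normed_field"
  assumes "f differentiable (at x)"
  shows "(\<lambda>j. of_nat (Suc j) * (f (x + axis i (1 / real (Suc j))) - f x)) \<longlonglongrightarrow> partial_deriv i f x"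
proof -
  let ?D = "frechet_derivative f (at x)" and ?h = "\<lambda>j. axis i (1 / real (Suc j)) :: real^'n"
  let ?q = "\<lambda>j. of_nat (Suc j) * (f (x + ?h j) - f x)"
  have D: "(f has_derivative ?D) (at x)"
    using assms by (simp add: frechet_derivative_works)
  then interpret bounded_linear ?D by (rule has_derivative_bounded_linear)
  have h: "?h j = (1 / real (Suc j)) *\<^sub>R axis i 1" for j
    by (simp add: vec_eq_iff axis_def)
  have "(\<lambda>h. norm (f (x + h) - f x - ?D h) / norm h) \<midarrow>0\<rightarrow> 0"
    using D by (simp add: has_derivative_at)
  moreover have "filterlim ?h (at 0) sequentially"
    unfolding filterlim_at h
    using tendsto_scaleR[OF LIMSEQ_inverse_real_of_nat tendsto_const[of "axis i 1 :: real^'n"]]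
    by (simp add: inverse_eq_divide axis_eq_0_iff)
  ultimately have lim: "(\<lambda>j. norm (f (x + ?h j) - f x - ?D (?h j)) / norm (?h j)) \<longlonglongrightarrow> 0"
    by (rule filterlim_compose)
  have eq: "norm (f (x + ?h j) - f x - ?D (?h j)) / norm (?h j) = norm (?q j - partial_deriv i f x)" for j
  proof -
    have q: "?q j - partial_deriv i f x = real (Suc j) *\<^sub>R (f (x + ?h j) - f x - ?D (?h j))"
      unfolding h scaleR scaleR_diff_right
      by (simp add: partial_deriv_def scaleR_conv_of_real right_diff_distrib del: of_nat_Suc)
    have n: "norm (?h j) = 1 / real (Suc j)"
      unfolding h norm_scaleR by simp
    show ?thesis
      unfolding q n norm_scaleR by simp
  qed
  show ?thesis
    by (rule LIM_zero_cancel, rule tendsto_norm_zero_cancel) (rule lim[unfolded eq])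
qed

text \<open>Differentiation of \<open>v \<phi>\<close> in the parameter preserves continuity in \<open>\<phi>\<close>: the difference quotients
  are linear combinations of two functionals from the induction hypothesis.\<close>

lemma iter_partial_family_tempered:
  fixes v :: "('k::{real_normed_field, banach}, 'n::finite, 'm::finite) family"
  assumes v: "v \<in> schwartz_families"
  shows "(\<lambda>\<phi>. iter_partial is (family_image v \<phi>) x) \<in> tempered_distributions"
proof (induction "is" arbitrary: x)
  case Nil
  then show ?case
    using v by (simp add: schwartz_families_def family_image_def)
next
  case (Cons i "is")
  have "iter_partial is (family_image v \<phi>) differentiable (at x)" for \<phi>
    using v by (simp add: schwartz_families_def schwartz_functions_def smooth_fun_def)
  from partial_deriv_LIMSEQ[OF this]
  have lim: "(\<lambda>j. of_nat (Suc j) * (iter_partial is (family_image v \<phi>) (x + axis i (1 / real (Suc j)))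
      + (- 1) * iter_partial is (family_image v \<phi>) x)) \<longlonglongrightarrow> iter_partial (i # is) (family_image v \<phi>) x" for \<phi>
    by (simp del: of_nat_Suc)
  show ?case
    by (rule tempered_distributions_limit[OF _ lim])
      (intro tempered_distributions_scale tempered_distributions_add Cons.IH)
qed

lemma schwartz_apply_family_operator:
  assumes "v \<in> schwartz_families"
  shows "schwartz_apply (family_operator v \<phi>) = family_image v \<phi>"
  using assms by (simp add: schwartz_families_def family_operator_def Schwartz_inverse)

text \<open>For each seminorm of the target, the uniform boundedness theorem is applied to the weighted
  derivatives at all points \<open>x\<close> simultaneously.\<close>

theorem family_operator_in_schwartz_operators:
  fixes v :: "('k::{real_normed_field, banach}, 'n::finite, 'm::finite) family"
  assumes v: "v \<in> schwartz_families"
  shows "family_operator v \<in> schwartz_operators"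
proof (rule schwartz_operatorI)
  have "Vector_Spaces.linear schwartz_scale (*) (v p)" for p
    using v by (simp add: schwartz_families_def tempered_distributions_def)
  then show "Vector_Spaces.linear schwartz_scale schwartz_scale (family_operator v)"
    unfolding linear_schwartz_iff linear_functional_iff schwartz_apply_inject[symmetric]
    by (simp add: schwartz_apply_family_operator[OF v] plus_schwartz.rep_eq schwartz_scale.rep_eq
        family_image_def)
  fix k :: "('m \<Rightarrow> nat) \<times> 'm list"
  obtain \<alpha> "is" where k: "k = (\<alpha>, is)" by fastforce
  define F where "F = range (\<lambda>x \<phi>. of_real (monomial \<alpha> x) * iter_partial is (family_image v \<phi>) x)"
  have "\<exists>m C. \<forall>u\<in>F. \<forall>\<phi>. norm (u \<phi>) \<le> C * graded_seminorm m \<phi>"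
  proof (rule schwartz_uniform_boundedness)
    show "F \<subseteq> tempered_distributions"
      unfolding F_def using iter_partial_family_tempered[OF v] tempered_distributions_scale by blast
    fix \<phi>
    have "norm (u \<phi>) \<le> schwartz_seminorm k (family_operator v \<phi>)" if "u \<in> F" for u
      using that le_schwartz_seminorm[of \<alpha> _ "is" "family_operator v \<phi>"]
      by (auto simp: F_def k schwartz_apply_family_operator[OF v] norm_mult)
    then show "\<exists>B. \<forall>u\<in>F. norm (u \<phi>) \<le> B" by blast
  qed
  then obtain m C where "\<And>x \<phi>. norm (monomial \<alpha> x *\<^sub>R iter_partial is (family_image v \<phi>) x)
      \<le> C * graded_seminorm m \<phi>"
    by (auto simp: F_def scaleR_conv_of_real)
  then have "schwartz_seminorm k (family_operator v \<phi>) \<le> C * graded_seminorm m \<phi>" for \<phi>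
    unfolding k by (intro schwartz_seminorm_le) (simp add: schwartz_apply_family_operator[OF v])
  then show "\<exists>m C. \<forall>\<phi>. schwartz_seminorm k (family_operator v \<phi>) \<le> C * graded_seminorm m \<phi>"
    by blast
qed

lemma dirac_tempered: "(dirac p :: ('k::real_normed_field, 'm::finite) schwartz \<Rightarrow> 'k) \<in> tempered_distributions"
proof (rule tempered_distributionI)
  show "Vector_Spaces.linear schwartz_scale (*) (dirac p :: ('k, 'm) schwartz \<Rightarrow> 'k)"
    by (simp add: linear_functional_iff dirac_def plus_schwartz.rep_eq schwartz_scale.rep_eq)
  show "norm (dirac p \<psi>) \<le> 1 * graded_seminorm (to_nat ((\<lambda>_. 0, []) :: ('m \<Rightarrow> nat) \<times> 'm list)) \<psi>"
    for \<psi> :: "('k, 'm) schwartz"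
    using le_schwartz_seminorm[of "\<lambda>_. 0" p "[]" \<psi>] schwartz_seminorm_le_graded[OF order_refl, of "(\<lambda>_. 0, [])" \<psi>]
    by (simp add: dirac_def monomial_def)
qed

lemma family_image_operator_family: "family_image (operator_family A) \<phi> = schwartz_apply (A \<phi>)"
  by (simp add: family_image_def operator_family_def dirac_def)

lemma operator_family_in_schwartz_families:
  fixes A :: "('k::real_normed_field, 'n::finite) schwartz \<Rightarrow> ('k, 'm::finite) schwartz"
  assumes A: "A \<in> schwartz_operators"
  shows "operator_family A \<in> schwartz_families"
proof -
  have "dirac p \<circ> A \<in> tempered_distributions" for p
  proof -
    have "continuous_on UNIV (dirac p \<circ> A)"
      using A dirac_tempered[where 'k = 'k, of p]
      by (intro continuous_on_compose)
        (auto simp: tempered_distributions_def schwartz_operators_def intro: continuous_on_subset)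
    then show ?thesis
      using A dirac_tempered[where 'k = 'k, of p]
      by (simp add: tempered_distributions_def schwartz_operators_def linear_functional_iff
          linear_schwartz_iff)
  qed
  then show ?thesis
    by (simp add: schwartz_families_def operator_family_def[of A] family_image_operator_family[unfolded operator_family_def] schwartz_apply)
qed

lemma operator_family_family_operator:
  "v \<in> schwartz_families \<Longrightarrow> operator_family (family_operator v) = v"
  by (simp add: operator_family_def dirac_def fun_eq_iff schwartz_apply_family_operator family_image_def)

lemma family_operator_operator_family: "family_operator (operator_family A) = A"
  by (simp add: family_operator_def family_image_operator_family schwartz_apply_inverse)

lemma vector_space_pointwise_scale:
  assumes "vector_space s"
  shows "vector_space (pointwise_scale s)"
proof -
  interpret vector_space s by fact
  show ?thesis
    by unfold_locales (simp_all add: pointwise_scale_def fun_eq_iff algebra_simps)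
qed

lemma vector_space_family_scale: "vector_space family_scale"
  unfolding family_scale_def
  by (intro vector_space_pointwise_scale vector_space_over_itself.vector_space_axioms)

lemma vector_space_operator_scale: "vector_space operator_scale"
  unfolding operator_scale_def by (intro vector_space_pointwise_scale vector_space_schwartz_scale)

lemma subspace_schwartz_families:
  "module.subspace family_scale (schwartz_families :: ('k::real_normed_field, 'n::finite, 'm::finite) family set)"
proof -
  interpret vector_space "family_scale :: 'k \<Rightarrow> ('k, 'n, 'm) family \<Rightarrow> _"
    by (rule vector_space_family_scale)
  have "v + w \<in> schwartz_families"
    if "v \<in> schwartz_families" "w \<in> schwartz_families" for v w :: "('k, 'n, 'm) family"
    using that by (simp add: schwartz_families_def family_image_def plus_fun_def
        tempered_distributions_add schwartz_functions_add)
  moreover have scale: "family_scale c v \<in> schwartz_families"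
    if "v \<in> schwartz_families" for c and v :: "('k, 'n, 'm) family"
    using that by (simp add: schwartz_families_def family_image_def family_scale_def
        pointwise_scale_def tempered_distributions_scale schwartz_functions_scale)
  moreover have "(0 :: ('k, 'n, 'm) family) \<in> schwartz_families"
  proof -
    have "(\<lambda>\<phi>. 0) \<in> (tempered_distributions :: (('k, 'n) schwartz \<Rightarrow> 'k) set)"
      by (simp add: tempered_distributions_def linear_functional_iff)
    then show ?thesis
      by (simp add: schwartz_families_def family_image_def zero_fun_def schwartz_functions_zero)
  qed
  ultimately show ?thesis by (simp add: subspace_def)
qed

lemma operator_family_add: "operator_family (A + B) = operator_family A + operator_family B"
  by (simp add: operator_family_def dirac_def fun_eq_iff plus_schwartz.rep_eq)

lemma operator_family_scale: "operator_family (operator_scale c A) = family_scale c (operator_family A)"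
  by (simp add: operator_family_def dirac_def fun_eq_iff operator_scale_def family_scale_def
      pointwise_scale_def schwartz_scale.rep_eq)

text \<open>Linearity is required of the explicit map \<open>g\<close> only; \<open>W\<close> is a subspace as the preimage of \<open>V\<close>
  under \<open>g\<close>, and \<open>f\<close> is linear as its inverse. For operators and families this
  spares a separate proof that continuous operators are closed under addition.\<close>

lemma vector_space_iso_on_inverse:
  assumes sV: "vector_space sV" and sW: "vector_space sW" and V: "module.subspace sV V"
    and add: "\<And>x y. g (x + y) = g x + g y" and scale: "\<And>c x. g (sW c x) = sV c (g x)"
    and f: "f ` V \<subseteq> W" and g: "g ` W \<subseteq> V"
    and gf: "\<And>x. x \<in> V \<Longrightarrow> g (f x) = x" and fg: "\<And>y. f (g y) = y"
  shows "vector_space_iso_on sV V sW W f \<and> vector_space_iso_on sW W sV V g"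
proof -
  interpret V: vector_space sV by fact
  interpret W: vector_space sW by fact
  have W_iff: "y \<in> W \<longleftrightarrow> g y \<in> V" for y using f g fg by (metis image_subset_iff)
  have "g 0 = 0" using add[of 0 0] by simp
  then have "W.subspace W"
    using V unfolding V.subspace_def W.subspace_def by (simp add: W_iff add scale)
  moreover have "f (x + y) = f x + f y" if "x \<in> V" "y \<in> V" for x y
    using that fg by (metis add gf)
  moreover have "f (sV c x) = sW c (f x)" if "x \<in> V" for c x
    using that fg by (metis scale gf)
  moreover have "bij_betw f V W" "bij_betw g W V"
    by (rule bij_betw_byWitness[of _ g], use f g gf fg in auto)
       (rule bij_betw_byWitness[of _ f], use f g gf fg in auto)
  ultimately show ?thesis
    using sV sW V add scale by (simp add: vector_space_iso_on_def)
qed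

theorem mainTheorem2:
  shows "vector_space_iso_on
      family_scale
      (schwartz_families :: ('k::{real_normed_field, euclidean_space}, 'n::finite, 'm::finite) family set)
      operator_scale
      (schwartz_operators :: (('k, 'n) schwartz \<Rightarrow> ('k, 'm) schwartz) set)
      family_operator \<and>
    vector_space_iso_on
      operator_scale
      (schwartz_operators :: (('k, 'n) schwartz \<Rightarrow> ('k, 'm) schwartz) set)
      family_scale
      (schwartz_families :: ('k, 'n, 'm) family set)
      operator_family \<and>
    (\<forall>v \<in> (schwartz_families :: ('k, 'n, 'm) family set).
      operator_family (family_operator v) = v) \<and>
    (\<forall>A \<in> (schwartz_operators :: (('k, 'n) schwartz \<Rightarrow> ('k, 'm) schwartz) set).
      family_operator (operator_family A) = A)"
proof -
  have "vector_space_iso_on family_scale (schwartz_families :: ('k, 'n, 'm) family set)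
      operator_scale (schwartz_operators :: (('k, 'n) schwartz \<Rightarrow> ('k, 'm) schwartz) set) family_operator \<and>
    vector_space_iso_on operator_scale (schwartz_operators :: (('k, 'n) schwartz \<Rightarrow> ('k, 'm) schwartz) set)
      family_scale (schwartz_families :: ('k, 'n, 'm) family set) operator_family"
    by (rule vector_space_iso_on_inverse)
      (auto simp: vector_space_family_scale vector_space_operator_scale subspace_schwartz_families
        operator_family_add operator_family_scale family_operator_in_schwartz_operators
        operator_family_in_schwartz_families operator_family_family_operator
        family_operator_operator_family)
  then show ?thesis
    by (simp add: operator_family_family_operator family_operator_operator_family)
qed

end
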